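(* For all integers $n > k >0$, $\mathrm{rank}_{\mathrm{bin}}(D_{n,k}) \geq \min(\mathrm{rank}_{\mathbb{R}}(D_{n,k})+1,n)$.
   Context: For integers $n \ge k \ge 0$, $D_{n,k}$ denotes the $n\times n$ circulant $0,1$ matrix whose first row consists of $n-k$ ones followed by $k$ zeros, each subsequent row being the cyclic shift of the previous row by one position to the right. The binary rank $\mathrm{rank}_{\mathrm{bin}}(A)$ of a $0,1$ matrix $A$ is the smallest number of combinatorial rectangles (all-one submatrices indexed by a set of rows times a set of columns) that partition the ones of $A$ (equivalently, the smallest inner dimension of a factorization $A=A_1A_2$ over the reals with $0,1$ factors). $\mathrm{rank}_{\mathbb{R}}$ denotes the rank over the reals. *)

theory Defs
  imports "Jordan_Normal_Form.DL_Rank" "HOL-Library.Disjoint_Sets"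
begin

definition D_mat :: "nat \<Rightarrow> nat \<Rightarrow> real mat" where
  "D_mat n k = mat n n (\<lambda>(i, j). if (j + (n - i)) mod n < n - k then 1 else 0)"

lemma D_mat_first_row:
  assumes "j < n"
  shows "D_mat n k $$ (0, j) = (if j < n - k then 1 else 0)"
  using assms by (simp add: D_mat_def)

lemma D_mat_shift:
  assumes "Suc i < n" "j < n"
  shows "D_mat n k $$ (Suc i, Suc j mod n) = D_mat n k $$ (i, j)"
proof -
  have "(Suc j mod n + (n - Suc i)) mod n = (Suc j + (n - Suc i)) mod n"
    by (simp add: mod_add_left_eq)
  also have "Suc j + (n - Suc i) = j + (n - i)"
    using assms by simp
  finally show ?thesis
    using assms by (simp add: D_mat_def)
qed

definition ones :: "real mat \<Rightarrow> (nat \<times> nat) set" where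
  "ones A = {(i, j). i < dim_row A \<and> j < dim_col A \<and> A $$ (i, j) = 1}"

definition rectangle_partition :: "real mat \<Rightarrow> (nat \<times> nat) set set \<Rightarrow> bool" where
  "rectangle_partition A P \<longleftrightarrow> partition_on (ones A) P \<and> (\<forall>R\<in>P. \<exists>X Y. R = X \<times> Y)"

text \<open>Members of a partition of the ones are nonempty and contained in the set of ones, so every
  member of a rectangle partition is an all-one submatrix.\<close>

definition rank_bin :: "real mat \<Rightarrow> nat" where
  "rank_bin A = (LEAST m. \<exists>P. finite P \<and> rectangle_partition A P \<and> card P = m)"

lemma finite_ones: "finite (ones A)"
  by (rule finite_subset[of _ "{..<dim_row A} \<times> {..<dim_col A}"]) (auto simp: ones_def)

text \<open>The minimum is attained, so the underspecified case of \<^const>\<open>Least\<close> never arises.\<close>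

lemma rank_bin_attained: "\<exists>P. finite P \<and> rectangle_partition A P \<and> card P = rank_bin A"
proof -
  let ?P = "(\<lambda>x. {x}) ` ones A"
  have "finite ?P" by (simp add: finite_ones)
  moreover have "\<exists>X Y. {x} = X \<times> Y" for x :: "nat \<times> nat"
    by (rule exI[of _ "{fst x}"], rule exI[of _ "{snd x}"]) auto
  then have "rectangle_partition A ?P"
    by (auto simp: rectangle_partition_def partition_on_def disjoint_def)
  ultimately have "\<exists>m P. finite P \<and> rectangle_partition A P \<and> card P = m" by blast
  then show ?thesis unfolding rank_bin_def by (rule LeastI_ex)
qed

end

theory Submission
  imports Defs "Jordan_Normal_Form.Determinant"
begin

text \<open>Put \<open>m = n - k\<close> and \<open>d = gcd m n\<close>. Suppose the ones of \<open>D = D_mat n k\<close> are partitioned into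
  \<open>p\<close> rectangles \<open>X\<^sub>r \<times> Y\<^sub>r\<close> with \<open>p \<le> rank D\<close> and \<open>p < n\<close>, and let \<open>D = A B\<close> be the corresponding
  factorization with 0/1 factors. Then \<open>A\<close> is injective and \<open>B\<close> is surjective, so each \<open>X\<^sub>r\<close> and each
  \<open>Y\<^sub>r\<close> is orthogonal to the \<open>d\<close>-periodic vectors of sum zero, which form the kernel of \<open>D\<close>; that is,
  \<open>X\<^sub>r\<close> and \<open>Y\<^sub>r\<close> have the same number \<open>s\<^sub>r\<close>, respectively \<open>t\<^sub>r\<close>, of elements in every residue class
  modulo \<open>d\<close>. If \<open>D u\<close> is the indicator vector of \<open>X\<^sub>r\<close>, then injectivity of \<open>A\<close> forces the sum of \<open>u\<close>
  over \<open>Y\<^sub>r\<close> to be \<open>1\<close>. Such a \<open>u\<close> can be chosen as an integer vector minus the constant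
  \<open>\<beta> s\<^sub>r / m\<close>, where \<open>m \<alpha> = n \<beta> + d\<close>, and the integrality of \<open>1\<close> then yields \<open>m / d dvd s\<^sub>r t\<^sub>r\<close>.
  Hence every rectangle has at least \<open>d m\<close> cells, and counting the \<open>n m\<close> ones gives \<open>d p \<le> n\<close>. This
  contradicts \<open>p \<ge> rank D \<ge> n - d + 1\<close>.\<close>

section \<open>Factorizations whose inner dimension is the rank\<close>

lemma mult_mat_unit_vec:
  fixes A :: "'a :: semiring_1 mat"
  assumes "A \<in> carrier_mat n nc" "j < nc"
  shows "A *\<^sub>v unit_vec nc j = col A j"
  using assms by (intro eq_vecI) auto

lemma mult_mat_vec_zero:
  fixes A :: "'a :: semiring_0 mat"
  assumes "A \<in> carrier_mat n nc"
  shows "A *\<^sub>v 0\<^sub>v nc = 0\<^sub>v n"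
  using assms by (intro eq_vecI) auto

text \<open>Padding \<open>B\<close> with zero rows to a square matrix keeps its kernel, and the
  zero row \<open>p\<close> makes the determinant vanish.\<close>

lemma wide_mat_kernel_nontrivial:
  fixes B :: "'a :: field mat"
  assumes B: "B \<in> carrier_mat p q" and "p < q"
  obtains v where "v \<in> carrier_vec q" "v \<noteq> 0\<^sub>v q" "B *\<^sub>v v = 0\<^sub>v p"
proof -
  define C where "C = mat q q (\<lambda>(i, j). if i < p then B $$ (i, j) else 0)"
  have C: "C \<in> carrier_mat q q"
    by (simp add: C_def)
  have "C = mat\<^sub>r q q (\<lambda>i. if i = p then 0\<^sub>v q else row C i)"
    by (intro eq_matI) (auto simp: C_def)
  moreover have "det (mat\<^sub>r q q (\<lambda>i. if i = p then 0\<^sub>v q else row C i)) = 0"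
    using C by (intro det_row_0 \<open>p < q\<close>) auto
  ultimately have "det C = 0" by simp
  then obtain v where v: "v \<in> carrier_vec q" "v \<noteq> 0\<^sub>v q" "C *\<^sub>v v = 0\<^sub>v q"
    using det_0_iff_vec_prod_zero_field[OF C] by blast
  have "B *\<^sub>v v = 0\<^sub>v p"
  proof (rule eq_vecI)
    fix i assume i: "i < dim_vec (0\<^sub>v p :: 'a vec)"
    then have "row B i = row C i"
      using B \<open>p < q\<close> by (intro eq_vecI) (auto simp: C_def)
    moreover have "row C i \<bullet> v = 0"
      using v(3) i C \<open>p < q\<close>
      by (metis carrier_matD(1) dim_vec index_mult_mat_vec index_zero_vec(1,2) less_trans)
    ultimately show "(B *\<^sub>v v) $ i = 0\<^sub>v p $ i"
      using B i by simp
  qed (use B in simp)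
  with v show thesis by (blast intro: that)
qed

text \<open>If the inner dimension of a factorization does not exceed the rank of the product, then
  \<open>p\<close> independent columns of \<open>A * B\<close> select an invertible \<open>p \<times> p\<close> submatrix of \<open>B\<close>.\<close>

lemma inner_dim_le_rank:
  fixes A B :: "'a :: field mat"
  assumes A: "A \<in> carrier_mat n p" and B: "B \<in> carrier_mat p nc"
    and le: "p \<le> vec_space.rank n (A * B)"
  shows inner_dim_le_rank_inj: "\<And>v. v \<in> carrier_vec p \<Longrightarrow> A *\<^sub>v v = 0\<^sub>v n \<Longrightarrow> v = 0\<^sub>v p"
    and inner_dim_le_rank_surj: "\<And>w. w \<in> carrier_vec p \<Longrightarrow> \<exists>u \<in> carrier_vec nc. B *\<^sub>v u = w"
proof -
  interpret vec_space "TYPE('a)" n .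
  have AB: "A * B \<in> carrier_mat n nc" using A B by simp
  obtain U where U: "U \<subseteq> set (cols (A * B))" "lin_indpt U" "card U = p"
  proof -
    obtain S where S: "maximal S (\<lambda>T. T \<subseteq> set (cols (A * B)) \<and> lin_indpt T)" "finite S"
    proof -
      have "{} \<subseteq> set (cols (A * B)) \<and> lin_indpt {}"
        by (simp add: lin_dep_def)
      then show thesis
        using maximal_exists_superset[of "set (cols (A * B))" "\<lambda>T. T \<subseteq> set (cols (A * B)) \<and> lin_indpt T" "{}"]
          that by auto
    qed
    have "p \<le> card S" using rank_card_indpt[OF AB S(1)] le by simp
    then obtain U where "U \<subseteq> S" "card U = p" by (meson obtain_subset_with_card_n)
    moreover have "S \<subseteq> set (cols (A * B))" "lin_indpt S" using S(1) by (auto simp: maximal_def)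
    ultimately show thesis using that[of U] subset_li_is_li[of S U] by blast
  qed
  \<comment> \<open>\<open>U\<close> is a set of vectors and equal columns may occur at several
    indices, so \<open>J\<close> picks one index for each.\<close>
  have "\<exists>J. U = col (A * B) ` J \<and> inj_on (col (A * B)) J \<and> J \<subseteq> {..<nc}"
  proof -
    have "U \<subseteq> col (A * B) ` {..<nc}" using U(1) B by (auto simp: cols_def atLeast0LessThan)
    then show ?thesis by (metis subset_image_inj)
  qed
  then obtain J where J: "U = col (A * B) ` J" "inj_on (col (A * B)) J" "J \<subseteq> {..<nc}" by blast
  have "finite J" using J(3) finite_subset by blast
  have "card J = p" using J U(3) card_image by metis
  then obtain f where f: "bij_betw f {..<p} J"
    using \<open>finite J\<close> ex_bij_betw_nat_finite[of J] by (auto simp: atLeast0LessThan)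
  have fnc: "f j < nc" if "j < p" for j
    using f J(3) that by (auto simp: bij_betw_def)
  \<comment> \<open>Right multiplication by \<open>E\<close> selects the columns of
    \<open>A * B\<close> that make up \<open>U\<close>.\<close>
  define E where "E = mat nc p (\<lambda>(i, j). if i = f j then 1 else 0 :: 'a)"
  have E: "E \<in> carrier_mat nc p" by (simp add: E_def)
  have colE: "col E j = unit_vec nc (f j)" if "j < p" for j
    using that fnc by (intro eq_vecI) (auto simp: E_def unit_vec_def)
  define M where "M = A * B * E"
  have M: "M \<in> carrier_mat n p" using AB E by (simp add: M_def)
  have colM: "col M j = col (A * B) (f j)" if "j < p" for j
  proof -
    have "col M j = (A * B) *\<^sub>v unit_vec nc (f j)"
      using that colE[OF that] col_mult2[OF AB E] by (simp add: M_def)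
    also have "\<dots> = col (A * B) (f j)"
      using mult_mat_unit_vec[OF AB fnc[OF that]] .
    finally show ?thesis .
  qed
  have colsM: "cols M = map (\<lambda>j. col (A * B) (f j)) [0..<p]"
    using M colM by (auto simp: cols_def intro!: map_cong)
  have "set (cols M) = U"
    using f by (auto simp: colsM J(1) bij_betw_def atLeast0LessThan image_comp[symmetric])
  moreover have "distinct (cols M)"
    using f J(2) by (auto simp: colsM distinct_map bij_betw_def inj_on_def atLeast0LessThan)
  ultimately have Minj: "v = 0\<^sub>v p" if "v \<in> carrier_vec p" "M *\<^sub>v v = 0\<^sub>v n" for v
    using lin_depI[OF M that(1) _ that(2)] U(2) by auto
  have BE: "B * E \<in> carrier_mat p p" using B E by simp
  have M_eq: "M *\<^sub>v v = A *\<^sub>v ((B * E) *\<^sub>v v)" if "v \<in> carrier_vec p" for v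
    using A B E that by (simp add: M_def assoc_mult_mat_vec[of _ n p _ p] assoc_mult_mat[OF A B E] BE)
  \<comment> \<open>A kernel vector of \<open>B * E\<close> would be one of \<open>M\<close>, whose
    columns are independent. Both conclusions are then read off the inverse
    \<open>C\<close>.\<close>
  have "det (B * E) \<noteq> 0"
  proof
    assume "det (B * E) = 0"
    then obtain v where v: "v \<in> carrier_vec p" "v \<noteq> 0\<^sub>v p" "(B * E) *\<^sub>v v = 0\<^sub>v p"
      using det_0_iff_vec_prod_zero_field[OF BE] by blast
    have "M *\<^sub>v v = 0\<^sub>v n" using M_eq[OF v(1)] v(3) mult_mat_vec_zero[OF A] by simp
    with Minj v show False by blast
  qed
  then obtain C where C: "C \<in> carrier_mat p p" "(B * E) * C = 1\<^sub>m p"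
    using det_non_zero_imp_unit[OF BE] by (auto simp: Units_def ring_mat_def)
  have inv: "(B * E) *\<^sub>v (C *\<^sub>v w) = w" if "w \<in> carrier_vec p" for w
    using assoc_mult_mat_vec[OF BE C(1) that] C(2) that by simp
  show "v = 0\<^sub>v p" if v: "v \<in> carrier_vec p" "A *\<^sub>v v = 0\<^sub>v n" for v
  proof -
    have Cv: "C *\<^sub>v v \<in> carrier_vec p" using C v by simp
    have "M *\<^sub>v (C *\<^sub>v v) = 0\<^sub>v n" using M_eq[OF Cv] inv[OF v(1)] v(2) by simp
    then have "C *\<^sub>v v = 0\<^sub>v p" using Minj Cv by blast
    then have "v = (B * E) *\<^sub>v 0\<^sub>v p" using inv[OF v(1)] by simp
    also have "\<dots> = 0\<^sub>v p" using mult_mat_vec_zero[OF BE] .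
    finally show ?thesis .
  qed
  show "\<exists>u \<in> carrier_vec nc. B *\<^sub>v u = w" if w: "w \<in> carrier_vec p" for w
  proof
    have Cw: "C *\<^sub>v w \<in> carrier_vec p" using C w by simp
    show "E *\<^sub>v (C *\<^sub>v w) \<in> carrier_vec nc" using E Cw by simp
    show "B *\<^sub>v (E *\<^sub>v (C *\<^sub>v w)) = w"
      using inv[OF w] assoc_mult_mat_vec[OF B E Cw] by simp
  qed
qed

section \<open>Sums of periodic sequences\<close>

lemma periodic_sum_shift:
  fixes f :: "nat \<Rightarrow> 'a :: ab_group_add"
  assumes "\<And>x. f (x + n) = f x"
  shows "(\<Sum>l<n. f (i + l)) = (\<Sum>l<n. f l)"
proof (induction i)
  case (Suc i)
  have "(\<Sum>l<n. f (Suc i + l)) + f i = (\<Sum>l<Suc n. f (i + l))"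
    by (subst sum.lessThan_Suc_shift) simp
  also have "\<dots> = (\<Sum>l<n. f (i + l)) + f i"
    using assms[of i] by simp
  finally show ?case using Suc by simp
qed simp

lemma sum_lessThan_mult:
  fixes f :: "nat \<Rightarrow> 'a :: comm_monoid_add"
  shows "(\<Sum>l<a * b. f l) = (\<Sum>h<a. \<Sum>l<b. f (h * b + l))"
proof (induction a)
  case (Suc a)
  have "(\<Sum>l<c + b. f l) = (\<Sum>l<c. f l) + (\<Sum>l<b. f (c + l))" for c
    by (induction b) (simp_all add: add.assoc)
  from this[of "a * b"] Suc show ?case by (simp add: add.commute)
qed simp

lemma periodic_mult:
  fixes f :: "nat \<Rightarrow> 'a"
  assumes "\<And>x. f (x + n) = f x"
  shows "f (x + h * n) = f x"
proof (induction h)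
  case (Suc h)
  have "f (x + Suc h * n) = f ((x + h * n) + n)" by (simp add: algebra_simps)
  with assms Suc show ?case by simp
qed simp

lemma periodic_window_sum:
  fixes f :: "nat \<Rightarrow> 'a :: comm_ring_1"
  assumes "\<And>x. f (x + d) = f x"
  shows "(\<Sum>l<h * d. f (i + l)) = of_nat h * (\<Sum>l<d. f l)"
proof -
  have "(\<Sum>l<d. f (i + (g * d + l))) = (\<Sum>l<d. f l)" for g
    using periodic_sum_shift[of f d "i + g * d"] assms by (simp add: add.assoc)
  then show ?thesis by (simp add: sum_lessThan_mult)
qed

lemma sum_shift_mod:
  fixes v :: "nat \<Rightarrow> 'a :: ab_group_add"
  assumes "0 < n"
  shows "(\<Sum>i<n. v ((i + l) mod n)) = (\<Sum>i<n. v i)"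
  using periodic_sum_shift[of "\<lambda>x. v (x mod n)" n l] by (simp add: add.commute)

section \<open>Cyclic window sums factored through rectangles\<close>

text \<open>With \<open>n = d * q\<close> the bounds give \<open>p \<le> q\<close> and then
  \<open>d * q < d + q\<close>, which fails for \<open>d, q \<ge> 2\<close>. Here
  \<open>q > 1\<close> since \<open>d \<le> m < n\<close>, and for \<open>d = 1\<close> the last
  hypothesis is already the claim.\<close>

lemma gcd_bounds_imp_le:
  fixes d m n p :: nat
  assumes "d dvd m" "d dvd n" "0 < m" "m < n" "d * p \<le> n" "n < d + p"
  shows "n \<le> p"
proof (rule ccontr)
  assume "\<not> n \<le> p"
  obtain q m' where q: "n = d * q" and m': "m = d * m'"
    using assms(1,2) by (auto elim!: dvdE)
  have "1 < q"
    using assms(3,4) by (auto simp: q m')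
  have "p \<le> q"
    using assms(3,5) by (simp add: q m')
  then have "d * q < d + q"
    using assms(6) by (simp add: q)
  moreover have "2 \<le> d"
    using assms(6) \<open>\<not> n \<le> p\<close> by simp
  obtain e f where "d = e + 2" "q = f + 2"
    using \<open>2 \<le> d\<close> \<open>1 < q\<close> by (metis add.commute less_eqE Suc_1 Suc_leI)
  ultimately show False by (simp add: algebra_simps)
qed

text \<open>Matrix-free form of \<open>D = A * B\<close>: \<open>factor\<close> applies the product
  to a vector, \<open>left_inj\<close> and \<open>right_surj\<close> concern \<open>A\<close> and
  \<open>B\<close>, and \<open>right_kernel\<close> gives a dependency among the first
  \<open>q\<close> columns of \<open>B\<close>.\<close>

locale window_factorization =
  fixes n m p :: nat and X Y :: "nat \<Rightarrow> nat set"
  assumes m_pos: "0 < m" and m_less: "m < n"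
    and X_sub: "\<And>r. r < p \<Longrightarrow> X r \<subseteq> {..<n}" and Y_sub: "\<And>r. r < p \<Longrightarrow> Y r \<subseteq> {..<n}"
    and X_ne: "\<And>r. r < p \<Longrightarrow> X r \<noteq> {}" and Y_ne: "\<And>r. r < p \<Longrightarrow> Y r \<noteq> {}"
    and factor: "\<And>(v :: nat \<Rightarrow> real) i. i < n \<Longrightarrow>
      (\<Sum>r<p. of_bool (i \<in> X r) * (\<Sum>y\<in>Y r. v y)) = (\<Sum>l<m. v ((i + l) mod n))"
    and left_inj: "\<And>c :: nat \<Rightarrow> real. (\<And>i. i < n \<Longrightarrow> (\<Sum>r<p. of_bool (i \<in> X r) * c r) = 0) \<Longrightarrow>
      (\<And>r. r < p \<Longrightarrow> c r = 0)"
    and right_surj: "\<And>c :: nat \<Rightarrow> real. \<exists>u. \<forall>r<p. (\<Sum>y\<in>Y r. u y) = c r"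
    and right_kernel: "\<And>q. p < q \<Longrightarrow> q \<le> n \<Longrightarrow>
      \<exists>v :: nat \<Rightarrow> real. (\<exists>j<q. v j \<noteq> 0) \<and> (\<forall>j\<ge>q. v j = 0) \<and> (\<forall>r<p. (\<Sum>y\<in>Y r. v y) = 0)"
begin

lemma n_pos: "0 < n"
  using m_less by simp

definition d :: nat where "d = gcd m n"

lemma d_pos: "0 < d" and d_dvd_m: "d dvd m" and d_dvd_n: "d dvd n"
  using m_pos by (auto simp: d_def)

lemma m_div_d_pos: "0 < m div d"
  using d_dvd_m m_pos d_pos by (simp add: div_greater_zero_iff dvd_imp_le)

text \<open>\<open>A\<close> maps both \<open>B u\<close> and the \<open>r\<close>-th unit vector to
  the indicator of \<open>X r\<close>, so injectivity makes them equal.\<close>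

lemma window_solution_unique:
  assumes "\<And>i. i < n \<Longrightarrow> (\<Sum>l<m. u ((i + l) mod n)) = of_bool (i \<in> X r)" and "r < p"
  shows "(\<Sum>y\<in>Y r. u y) = (1 :: real)"
proof -
  have "(\<Sum>r'<p. of_bool (i \<in> X r') * ((\<Sum>y\<in>Y r'. u y) - of_bool (r' = r))) = 0" if "i < n" for i
  proof -
    have "(\<Sum>r'<p. of_bool (i \<in> X r') * of_bool (r' = r)) = (of_bool (i \<in> X r) :: real)"
      using \<open>r < p\<close> by (subst sum.remove[of _ r]) (auto intro!: sum.neutral)
    then show ?thesis
      using factor[OF that, of u] assms(1)[OF that] by (simp add: right_diff_distrib sum_subtractf)
  qed
  from left_inj[OF this \<open>r < p\<close>] show ?thesis by simp
qed

section \<open>Equidistribution of the rectangle sides modulo \<open>d\<close>\<close>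

text \<open>The difference \<open>v\<close> of the two indicators is \<open>d\<close>-periodic with
  sum zero over a period. A window of length \<open>m\<close> consists of \<open>m div d\<close>
  periods, so \<open>D v = 0\<close>, and injectivity of \<open>A\<close> gives
  \<open>B v = 0\<close>.\<close>

lemma residue_sums_Y:
  assumes "r < p" "c < d"
  shows "(\<Sum>y\<in>Y r. of_bool (y mod d = c)) = (\<Sum>y\<in>Y r. of_bool (y mod d = 0) :: real)"
proof -
  define v :: "nat \<Rightarrow> real" where "v y = of_bool (y mod d = c) - of_bool (y mod d = 0)" for y
  have per: "v (x mod n) = v x" for x
    using d_dvd_n by (simp add: v_def mod_mod_cancel)
  have "(\<Sum>l<d. v l) = (\<Sum>l<d. of_bool (l = c)) - (\<Sum>l<d. of_bool (l = 0))"
    unfolding v_def sum_subtractf by (intro arg_cong2[of _ _ _ _ "(-)"] sum.cong) auto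
  also have "\<dots> = 0"
    using assms(2) d_pos by (simp add: of_bool_def)
  finally have v0: "(\<Sum>l<d. v l) = 0" .
  have window: "(\<Sum>l<m. v ((i + l) mod n)) = 0" for i
  proof -
    have "(\<Sum>l<(m div d) * d. v (i + l)) = of_nat (m div d) * (\<Sum>l<d. v l)"
      by (rule periodic_window_sum) (simp add: v_def)
    then show ?thesis using d_dvd_m v0 by (simp add: per)
  qed
  have "(\<Sum>y\<in>Y r. v y) = 0"
    by (rule left_inj[OF _ assms(1)]) (simp only: factor window)
  then show ?thesis by (simp add: v_def sum_subtractf)
qed

definition t :: "nat \<Rightarrow> nat" where "t r = card {y \<in> Y r. y mod d = 0}"

lemma card_Y:
  assumes "r < p"
  shows "card (Y r) = d * t r"
proof -
  have fin: "finite (Y r)" using Y_sub[OF assms] finite_subset by blast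
  have "real (card (Y r)) = (\<Sum>y\<in>Y r. \<Sum>c<d. of_bool (y mod d = c))"
    using d_pos by (simp add: of_bool_def)
  also have "\<dots> = (\<Sum>c<d. \<Sum>y\<in>Y r. of_bool (y mod d = c))"
    by (rule sum.swap)
  also have "\<dots> = (\<Sum>c<d. real (t r))"
  proof (rule sum.cong)
    fix c assume "c \<in> {..<d}"
    then have "(\<Sum>y\<in>Y r. of_bool (y mod d = c)) = (\<Sum>y\<in>Y r. of_bool (y mod d = 0) :: real)"
      using residue_sums_Y[OF assms] by blast
    also have "\<dots> = real (t r)"
      using fin by (simp add: t_def of_bool_def sum.If_cases Int_def del: mod_eq_0_iff_dvd)
    finally show "(\<Sum>y\<in>Y r. of_bool (y mod d = c)) = real (t r)" .
  qed simp
  finally show ?thesis by (simp flip: of_nat_mult)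
qed

definition a :: "nat \<Rightarrow> nat \<Rightarrow> int" where "a r x = of_bool (x mod n \<in> X r)"

definition s :: "nat \<Rightarrow> int" where "s r = (\<Sum>h<n div d. a r (h * d))"

text \<open>If \<open>B u\<close> is the \<open>r\<close>-th unit vector, then \<open>D u\<close> is
  the indicator of \<open>X r\<close>. Sliding the window by one expresses the increments of
  \<open>a r\<close> through \<open>u\<close>, and these cancel along a residue class modulo
  \<open>d\<close>.\<close>

lemma residue_sums_X:
  assumes "r < p"
  shows "(\<Sum>h<n div d. a r (c + h * d)) = s r"
proof (induction c)
  case (Suc c)
  obtain u :: "nat \<Rightarrow> real" where u: "\<forall>r'<p. (\<Sum>y\<in>Y r'. u y) = of_bool (r' = r)"
    using right_surj[of "\<lambda>r'. of_bool (r' = r)"] by blast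
  have win: "(\<Sum>l<m. u ((i + l) mod n)) = of_int (a r i)" for i
  proof -
    have "(\<Sum>r'<p. of_bool (i mod n \<in> X r') * (\<Sum>y\<in>Y r'. u y)) =
        (\<Sum>r'<p. of_bool (i mod n \<in> X r') * of_bool (r' = r))"
      using u by (intro sum.cong) auto
    also have "\<dots> = of_int (a r i)"
      using assms by (subst sum.remove[of _ r]) (auto intro!: sum.neutral simp: a_def)
    finally show ?thesis
      using factor[of "i mod n" u] n_pos by (simp add: mod_add_left_eq)
  qed
  have step: "of_int (a r (Suc i)) - of_int (a r i) = u ((i + m) mod n) - u (i mod n)" for i
  proof -
    have "(\<Sum>l<m. u ((Suc i + l) mod n)) + u (i mod n) = (\<Sum>l<Suc m. u ((i + l) mod n))"
      by (subst sum.lessThan_Suc_shift) simp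
    then have "of_int (a r (Suc i)) + u (i mod n) = of_int (a r i) + u ((i + m) mod n)"
      by (simp only: win sum.lessThan_Suc)
    then show ?thesis by simp
  qed
  \<comment> \<open>Along this class a shift by \<open>m\<close> is a shift of \<open>h\<close> by
    \<open>m div d\<close>, and \<open>g\<close> has period \<open>n div d\<close>.\<close>
  define g where "g h = u ((c + h * d) mod n)" for h
  have "g (h + n div d) = g h" for h
  proof -
    have "c + (h + n div d) * d = c + h * d + n"
      using d_dvd_n by (simp add: algebra_simps)
    then show ?thesis by (simp only: g_def mod_add_self2)
  qed
  then have "(\<Sum>h<n div d. g (m div d + h)) = (\<Sum>h<n div d. g h)"
    by (rule periodic_sum_shift)
  moreover have "g (m div d + h) = u ((c + h * d + m) mod n)" for h
    using d_dvd_m by (simp add: g_def algebra_simps)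
  ultimately have "(\<Sum>h<n div d. u ((c + h * d + m) mod n) - u ((c + h * d) mod n)) = 0"
    by (simp add: sum_subtractf g_def)
  then have "(\<Sum>h<n div d. of_int (a r (Suc c + h * d)) - of_int (a r (c + h * d)) :: real) = 0"
    using step by simp
  then have "real_of_int (\<Sum>h<n div d. a r (Suc c + h * d)) = of_int (\<Sum>h<n div d. a r (c + h * d))"
    by (simp add: sum_subtractf)
  then have "(\<Sum>h<n div d. a r (Suc c + h * d)) = (\<Sum>h<n div d. a r (c + h * d))"
    by (simp only: of_int_eq_iff)
  then show ?case using Suc by simp
qed (simp add: s_def)

lemma card_X:
  assumes "r < p"
  shows "int (card (X r)) = int d * s r"
proof -
  have "int (card (X r)) = (\<Sum>x<n. a r x)"
    using X_sub[OF assms] by (simp add: a_def of_bool_def sum.If_cases Int_absorb1 inf.commute)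
  also have "\<dots> = (\<Sum>x<(n div d) * d. a r x)"
    using d_dvd_n by simp
  also have "\<dots> = (\<Sum>h<n div d. \<Sum>c<d. a r (c + h * d))"
    by (simp add: sum_lessThan_mult add.commute)
  also have "\<dots> = (\<Sum>c<d. \<Sum>h<n div d. a r (c + h * d))"
    by (rule sum.swap)
  also have "\<dots> = int d * s r"
    by (simp add: residue_sums_X[OF assms])
  finally show ?thesis .
qed

section \<open>An integral potential and the divisibility it yields\<close>

text \<open>This is the whole tail sum along the progression from \<open>x\<close> with step
  \<open>d\<close>: since \<open>x + (n div d) * d \<ge> n\<close>, no term below \<open>n\<close>
  is missed.\<close>

definition S :: "nat \<Rightarrow> nat \<Rightarrow> int" where
  "S r x = (\<Sum>h<n div d. if x + h * d < n then a r (x + h * d) else 0)"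

lemma S_step: "S r x = (if x < n then a r x else 0) + S r (x + d)"
proof -
  define f where "f h = (if x + h * d < n then a r (x + h * d) else 0)" for h
  have "S r x + f (n div d) = (\<Sum>h<Suc (n div d). f h)"
    by (simp add: S_def f_def)
  also have "\<dots> = f 0 + (\<Sum>h<n div d. f (Suc h))"
    by (rule sum.lessThan_Suc_shift)
  finally show ?thesis
    using d_dvd_n by (simp add: S_def f_def add.assoc cong: if_cong)
qed

lemma S_ge: "n \<le> x \<Longrightarrow> S r x = 0"
  by (simp add: S_def)

lemma S_less:
  assumes "r < p" "x < d"
  shows "S r x = s r"
proof -
  have "x + h * d < n" if "h < n div d" for h
  proof -
    have "x + h * d < Suc h * d" using assms by simp
    also have "\<dots> \<le> (n div d) * d" using that by (intro mult_right_mono) auto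
    finally show ?thesis using d_dvd_n by simp
  qed
  then show ?thesis
    using residue_sums_X[OF assms(1), of x] by (simp add: S_def)
qed

text \<open>\<open>T r\<close> is a quasi-periodic potential: its negated first differences are \<open>n\<close>-periodic, and by
  telescoping their sum over a window of length \<open>d\<close> starting at \<open>x\<close> is \<open>T r x - T r (x + d) = a r x\<close>.\<close>

definition T :: "nat \<Rightarrow> nat \<Rightarrow> int" where
  "T r x = S r (x mod n) - s r * int (x div n)"

lemma T_add_mult_n: "T r (x + b * n) = T r x - int b * s r"
  using n_pos by (simp add: T_def algebra_simps)

text \<open>Inside a period this is \<open>S_step\<close>. When \<open>x + d\<close> wraps around,
  it lands on some \<open>z < d\<close> of the next period, where the full class sum
  \<open>S r z = s r\<close> cancels the correction from \<open>T_add_mult_n\<close>.\<close>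

lemma T_step:
  assumes "r < p"
  shows "T r x - T r (x + d) = a r x"
proof -
  have *: "T r y - T r (y + d) = a r y" if "y < n" for y
  proof (cases "y + d < n")
    case True
    with that S_step[of r y] show ?thesis by (simp add: T_def)
  next
    case False
    define z where "z = y + d - n"
    have z: "y + d = z + 1 * n" "z < d" using False that by (auto simp: z_def)
    have "d \<le> n" using d_dvd_n n_pos by (simp add: dvd_imp_le)
    have "T r (y + d) = T r z - s r"
      unfolding z(1) by (subst T_add_mult_n) simp
    also have "T r z = s r"
      using S_less[OF assms z(2)] z(2) \<open>d \<le> n\<close> by (simp add: T_def)
    finally show ?thesis
      using S_step[of r y] S_ge[of "y + d" r] False that by (simp add: T_def)
  qed
  have "T r x = T r (x mod n) - int (x div n) * s r"
    "T r (x + d) = T r (x mod n + d) - int (x div n) * s r"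
    using T_add_mult_n[of r "x mod n" "x div n"] T_add_mult_n[of r "x mod n + d" "x div n"]
    by (simp_all add: add.assoc add.commute add.left_commute)
  moreover have "a r (x mod n) = a r x" by (simp add: a_def)
  ultimately show ?thesis using *[of "x mod n"] n_pos by simp
qed

lemma m_div_d_dvd:
  assumes "r < p"
  shows "int (m div d) dvd s r * int (t r)"
proof -
  obtain \<alpha> \<beta> where bez: "m * \<alpha> = n * \<beta> + d"
    using bezout_nat[of m n] m_pos by (auto simp: d_def)
  \<comment> \<open>Windows of length \<open>m\<close> at the offsets \<open>h * m\<close> concatenate to one of length \<open>\<alpha> * m = \<beta> * n + d\<close>,
    over which the differences of \<open>T r\<close> telescope.\<close>
  define w where "w y = (\<Sum>h<\<alpha>. T r (y + h * m) - T r (Suc (y + h * m)))" for y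
  \<comment> \<open>A shift by a multiple of \<open>n\<close> changes all values of
    \<open>T r\<close> equally, which the differences in \<open>w\<close> do not see.\<close>
  have w_mod: "w (y mod n) = w y" for y
  proof -
    have "T r (y + z) = T r (y mod n + z) - int (y div n) * s r" for z
      using T_add_mult_n[of r "y mod n + z" "y div n"] by (simp add: algebra_simps)
    from this[of "h * m" for h] this[of "Suc (h * m)" for h] show ?thesis by (simp add: w_def)
  qed
  have w_window: "(\<Sum>l<m. w (i + l)) = a r i + int \<beta> * s r" for i
  proof -
    have "(\<Sum>l<m. w (i + l)) = (\<Sum>h<\<alpha>. \<Sum>l<m. T r (i + l + h * m) - T r (Suc (i + l + h * m)))"
      unfolding w_def by (rule sum.swap)
    also have "\<dots> = (\<Sum>l<\<alpha> * m. T r (i + l) - T r (i + Suc l))"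
      by (simp add: sum_lessThan_mult algebra_simps)
    also have "\<dots> = T r i - T r (i + \<alpha> * m)"
      using sum_lessThan_telescope'[of "\<lambda>l. T r (i + l)" "\<alpha> * m"] by simp
    also have "i + \<alpha> * m = (i + d) + \<beta> * n"
      using bez by (simp add: algebra_simps)
    finally show ?thesis using T_step[OF assms, of i] by (simp add: T_add_mult_n)
  qed
  \<comment> \<open>The constant removes the excess \<open>\<beta> * s r\<close> from every window
    sum of \<open>w\<close>.\<close>
  define u where "u y = of_int (w y) - real \<beta> * of_int (s r) / real m" for y
  have "(\<Sum>l<m. u ((i + l) mod n)) = of_bool (i \<in> X r)" if "i < n" for i
  proof -
    have "(\<Sum>l<m. u ((i + l) mod n)) = of_int (\<Sum>l<m. w (i + l)) - real \<beta> * of_int (s r)"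
      using m_pos by (simp add: u_def w_mod sum_subtractf)
    then show ?thesis using that by (simp add: w_window a_def)
  qed
  from window_solution_unique[OF this assms]
  have "of_int (\<Sum>y\<in>Y r. w y) - real (card (Y r)) * (real \<beta> * of_int (s r) / real m) = 1"
    by (simp add: u_def sum_subtractf)
  then have "real m * of_int ((\<Sum>y\<in>Y r. w y) - 1) = real (card (Y r)) * real \<beta> * of_int (s r)"
    using m_pos by (simp add: field_simps)
  then have "real_of_int (int m * ((\<Sum>y\<in>Y r. w y) - 1)) = real_of_int (int (card (Y r)) * int \<beta> * s r)"
    by simp
  then have "int m * ((\<Sum>y\<in>Y r. w y) - 1) = int (card (Y r)) * int \<beta> * s r"
    by (simp only: of_int_eq_iff)
  moreover have "int m = int d * int (m div d)"
    using d_dvd_m by (simp flip: of_nat_mult)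
  ultimately have "int d * (int (m div d) * ((\<Sum>y\<in>Y r. w y) - 1)) = int d * (int \<beta> * (s r * int (t r)))"
    by (simp add: card_Y[OF assms] algebra_simps)
  then have "int (m div d) * ((\<Sum>y\<in>Y r. w y) - 1) = int \<beta> * (s r * int (t r))"
    using d_pos by simp
  then have "int (m div d) dvd int \<beta> * (s r * int (t r))"
    by (metis dvd_triv_left)
  \<comment> \<open>Dividing the Bezout identity by \<open>d\<close> gives a combination of
    \<open>m div d\<close> and \<open>\<beta>\<close> equal to 1, so \<open>\<beta>\<close> can be
    cancelled.\<close>
  moreover have "coprime (int (m div d)) (int \<beta>)"
  proof -
    have "d * ((m div d) * \<alpha>) = d * ((n div d) * \<beta> + 1)"
      using bez d_dvd_m d_dvd_n by (simp add: algebra_simps)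
    then have "(m div d) * \<alpha> = (n div d) * \<beta> + 1"
      using d_pos by (simp only: mult_cancel1) simp
    then have "coprime (m div d) \<beta>"
      by (metis coprime_1_right coprime_add_one_left coprime_commute coprime_mult_left_iff)
    then show ?thesis by simp
  qed
  ultimately show ?thesis
    using coprime_dvd_mult_right_iff by blast
qed

section \<open>Bounds on the number of rectangles\<close>

text \<open>The product of the sides is \<open>d * d * s r * t r\<close>, and
  \<open>s r * t r\<close> is a positive multiple of \<open>m div d\<close>.\<close>

lemma mult_card_ge:
  assumes "r < p"
  shows "d * m \<le> card (X r) * card (Y r)"
proof -
  have "finite (X r)" "finite (Y r)" using X_sub[OF assms] Y_sub[OF assms] finite_subset by blast+
  then have "0 < card (X r)" "0 < card (Y r)" using X_ne[OF assms] Y_ne[OF assms] by (auto simp: card_gt_0_iff)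
  then have "0 < int d * s r" "0 < d * t r"
    using card_X[OF assms] card_Y[OF assms] by auto
  then have "0 < s r * int (t r)"
    by (simp add: zero_less_mult_iff)
  then have "int (m div d) \<le> s r * int (t r)"
    using m_div_d_dvd[OF assms] zdvd_imp_le by blast
  then have "int d * int d * int (m div d) \<le> int d * int d * (s r * int (t r))"
    by (intro mult_left_mono) auto
  moreover have "int m = int d * int (m div d)"
    using d_dvd_m by (simp flip: of_nat_mult)
  ultimately have "int (d * m) \<le> int (card (X r) * card (Y r))"
    by (simp add: card_X[OF assms] card_Y[OF assms] algebra_simps)
  then show ?thesis by (simp only: of_nat_le_iff)
qed

text \<open>Applying \<open>factor\<close> to the constant vector 1 counts the \<open>n * m\<close>
  ones, of which each rectangle takes at least \<open>d * m\<close>.\<close>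

lemma d_mult_p_le: "d * p \<le> n"
proof -
  have "(\<Sum>r<p. real (card (X r)) * real (card (Y r))) =
      (\<Sum>r<p. (\<Sum>i<n. of_bool (i \<in> X r)) * real (card (Y r)))"
  proof (intro sum.cong refl)
    fix r assume "r \<in> {..<p}"
    then show "real (card (X r)) * real (card (Y r)) = (\<Sum>i<n. of_bool (i \<in> X r)) * real (card (Y r))"
      using X_sub[of r] by (simp add: of_bool_def sum.If_cases Int_absorb1 inf.commute)
  qed
  also have "\<dots> = (\<Sum>r<p. \<Sum>i<n. of_bool (i \<in> X r) * real (card (Y r)))"
    by (simp only: sum_distrib_right)
  also have "\<dots> = (\<Sum>i<n. \<Sum>r<p. of_bool (i \<in> X r) * real (card (Y r)))"
    by (rule sum.swap)
  also have "\<dots> = real (n * m)"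
    using factor[of _ "\<lambda>_. 1"] by simp
  finally have "real (\<Sum>r<p. card (X r) * card (Y r)) = real (n * m)"
    by simp
  then have "(\<Sum>r<p. card (X r) * card (Y r)) = n * m"
    by (simp only: of_nat_eq_iff)
  moreover have "(\<Sum>r<p. d * m) \<le> (\<Sum>r<p. card (X r) * card (Y r))"
    using mult_card_ge by (intro sum_mono) auto
  ultimately have "(d * p) * m \<le> n * m"
    by (simp add: algebra_simps)
  then show ?thesis using m_pos by simp
qed

text \<open>Otherwise some nonzero \<open>v\<close> supported on the first \<open>n - d + 1\<close>
  places has \<open>D v = 0\<close>. Its periodic extension has periods \<open>n\<close> and
  \<open>m\<close>, hence \<open>d\<close>; it vanishes at \<open>d - 1\<close> consecutive places
  and has sum zero over a period, so it is zero.\<close>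

lemma n_less_d_plus_p: "n < d + p"
proof (rule ccontr)
  assume "\<not> n < d + p"
  then have "p < n - d + 1" by simp
  have "d \<le> n" using d_dvd_n n_pos by (simp add: dvd_imp_le)
  then have "n - d + 1 \<le> n" using d_pos by simp
  from right_kernel[OF \<open>p < n - d + 1\<close> this] obtain v :: "nat \<Rightarrow> real"
    where v: "\<exists>j<n-d+1. v j \<noteq> 0" "\<forall>j\<ge>n-d+1. v j = 0" "\<forall>r<p. (\<Sum>y\<in>Y r. v y) = 0" by blast
  define g where "g x = v (x mod n)" for x
  have g_add: "g (x + n) = g x" for x
    by (simp add: g_def)
  have win: "(\<Sum>l<m. g (i + l)) = 0" for i
    using factor[of "i mod n" v] v(3) n_pos by (simp add: g_def mod_add_left_eq)
  have g_m: "g (i + m) = g i" for i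
  proof -
    have "(\<Sum>l<m. g (Suc i + l)) + g i = (\<Sum>l<Suc m. g (i + l))"
      by (subst sum.lessThan_Suc_shift) simp
    then show ?thesis by (simp only: sum.lessThan_Suc win)
  qed
  obtain \<alpha> \<beta> where bez: "m * \<alpha> = n * \<beta> + d"
    using bezout_nat[of m n] m_pos by (auto simp: d_def)
  have g_d: "g (x + d) = g x" for x
  proof -
    have "g (x + d) = g (x + d + \<beta> * n)"
      using periodic_mult[of g n "x + d" \<beta>] g_add by simp
    also have "x + d + \<beta> * n = x + \<alpha> * m"
      using bez by (simp add: algebra_simps)
    also have "g \<dots> = g x"
      using periodic_mult[of g m x \<alpha>] g_m by simp
    finally show ?thesis .
  qed
  have g_mod: "g x = g (x mod d)" for x
    using periodic_mult[of g d "x mod d" "x div d", OF g_d] by (simp only: mod_div_mult_eq)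
  have g0: "g c = 0" if "0 < c" "c < d" for c
  proof -
    \<comment> \<open>This moves \<open>c\<close> into the last block of length \<open>d\<close>,
      where \<open>0 < c\<close> puts it beyond the support of \<open>v\<close>.\<close>
    have "g c = g (c + (n div d - 1) * d)"
      using periodic_mult[of g d c] g_d by simp
    also have "c + (n div d - 1) * d = n - d + c"
      using d_dvd_n by (simp add: diff_mult_distrib)
    also have "g \<dots> = 0"
      using v(2) that \<open>d \<le> n\<close> by (simp add: g_def)
    finally show ?thesis .
  qed
  have "0 = (\<Sum>l<(m div d) * d. g (0 + l))"
    using win[of 0] d_dvd_m by simp
  also have "\<dots> = real (m div d) * (\<Sum>l<d. g l)"
    by (rule periodic_window_sum) (rule g_d)
  also have "(\<Sum>l<d. g l) = g 0"
    using d_pos g0 by (subst sum.remove[of _ 0]) auto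
  finally have "g 0 = 0"
    using m_div_d_pos by simp
  then have "g x = 0" for x
    using g_mod[of x] g0[of "x mod d"] d_pos by (cases "x mod d = 0") auto
  then have "v j = 0" if "j < n" for j
    using that by (metis g_def mod_less)
  with v(1) \<open>n - d + 1 \<le> n\<close> show False by auto
qed

lemma p_ge_n: "n \<le> p"
  using gcd_bounds_imp_le[OF d_dvd_m d_dvd_n m_pos m_less d_mult_p_le n_less_d_plus_p] .

end

section \<open>The circulant matrix\<close>

definition row_mat :: "nat \<Rightarrow> nat \<Rightarrow> (nat \<Rightarrow> nat set) \<Rightarrow> real mat" where
  "row_mat n p X = mat n p (\<lambda>(i, r). of_bool (i \<in> X r))"

definition col_mat :: "nat \<Rightarrow> nat \<Rightarrow> (nat \<Rightarrow> nat set) \<Rightarrow> real mat" where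
  "col_mat p n Y = mat p n (\<lambda>(r, j). of_bool (j \<in> Y r))"

lemma row_mat_carrier [simp]: "row_mat n p X \<in> carrier_mat n p"
  by (simp add: row_mat_def)

lemma col_mat_carrier [simp]: "col_mat p n Y \<in> carrier_mat p n"
  by (simp add: col_mat_def)

lemma row_mat_mult_vec:
  assumes "c \<in> carrier_vec p" "i < n"
  shows "(row_mat n p X *\<^sub>v c) $ i = (\<Sum>r<p. of_bool (i \<in> X r) * c $ r)"
  using assms by (simp add: row_mat_def scalar_prod_def atLeast0LessThan)

text \<open>The cutoff \<open>q\<close> lets one formula serve both the full matrix and its first
  \<open>q\<close> columns.\<close>

lemma col_mat_mult_vec:
  assumes "v \<in> carrier_vec q" "r < p" "q \<le> n" "Y r \<subseteq> {..<n}"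
  shows "(col_mat p q Y *\<^sub>v v) $ r = (\<Sum>y\<in>Y r. if y < q then v $ y else 0)"
proof -
  have "(col_mat p q Y *\<^sub>v v) $ r = (\<Sum>y<q. of_bool (y \<in> Y r) * v $ y)"
    using assms by (simp add: col_mat_def scalar_prod_def atLeast0LessThan)
  also have "\<dots> = (\<Sum>y\<in>{..<q} \<inter> Y r. v $ y)"
    by (simp add: of_bool_def if_distrib[of "\<lambda>c. c * _"] sum.If_cases Int_def cong: if_cong)
  also have "\<dots> = (\<Sum>y\<in>Y r. if y < q then v $ y else 0)"
    using assms(4) by (simp add: Int_commute sum.If_cases finite_subset[OF assms(4)] lessThan_def)
  finally show ?thesis .
qed

text \<open>Counted cyclically from the diagonal, the ones of row \<open>i\<close> sit exactly at
  the offsets \<open>l < n - k\<close>.\<close>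

lemma D_mat_window_sum:
  assumes "i < n"
  shows "(\<Sum>y<n. D_mat n k $$ (i, y) * v y) = (\<Sum>l<n - k. v ((i + l) mod n))"
proof -
  have "((i + l) mod n + (n - i)) mod n = l" if "l < n" for l
  proof -
    have "((i + l) mod n + (n - i)) mod n = (i + l + (n - i)) mod n"
      by (simp add: mod_add_left_eq)
    also have "i + l + (n - i) = l + n" using assms by simp
    finally show ?thesis using that by simp
  qed
  then have entry: "D_mat n k $$ (i, (i + l) mod n) = of_bool (l < n - k)" if "l < n" for l
    using that assms by (simp add: D_mat_def)
  have "(\<Sum>y<n. D_mat n k $$ (i, y) * v y) =
      (\<Sum>l<n. D_mat n k $$ (i, (l + i) mod n) * v ((l + i) mod n))"
    using assms by (subst sum_shift_mod) auto
  also have "\<dots> = (\<Sum>l<n. of_bool (l < n - k) * v ((i + l) mod n))"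
    using entry by (intro sum.cong) (auto simp: add.commute)
  also have "\<dots> = (\<Sum>l<n - k. of_bool (l < n - k) * v ((i + l) mod n))"
    by (rule sum.mono_neutral_right) auto
  finally show ?thesis by simp
qed

text \<open>Every one of \<open>M\<close> lies in exactly one rectangle and every zero in none, so
  the products of side indicators add up to \<open>M\<close>.\<close>

lemma rectangle_partition_factorization:
  assumes "finite P" "rectangle_partition M P" "M \<in> carrier_mat n n'"
    and M01: "\<And>i j. i < n \<Longrightarrow> j < n' \<Longrightarrow> M $$ (i, j) \<in> {0, 1}"
  obtains X Y where "\<And>r. r < card P \<Longrightarrow> X r \<subseteq> {..<n}" "\<And>r. r < card P \<Longrightarrow> Y r \<subseteq> {..<n'}"
    "\<And>r. r < card P \<Longrightarrow> X r \<noteq> {}" "\<And>r. r < card P \<Longrightarrow> Y r \<noteq> {}"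
    "M = row_mat n (card P) X * col_mat (card P) n' Y"
proof -
  define p where "p = card P"
  obtain e where e: "bij_betw e {..<p} P"
    using ex_bij_betw_nat_finite[OF assms(1)] by (auto simp: atLeast0LessThan p_def)
  define X Y where "X r = fst ` e r" and "Y r = snd ` e r" for r
  have part: "partition_on (ones M) P" and rect: "\<And>R. R \<in> P \<Longrightarrow> \<exists>X Y. R = X \<times> Y"
    using assms(2) by (auto simp: rectangle_partition_def)
  have eP: "e r \<in> P" if "r < p" for r
    using e that by (auto simp: bij_betw_def)
  have e_ne: "e r \<noteq> {}" and e_sub: "e r \<subseteq> ones M" if "r < p" for r
    using part eP[OF that] by (auto simp: partition_on_def)
  \<comment> \<open>Projections recover the sides of a rectangle only if it is nonempty, hence
    \<open>e_ne\<close>.\<close>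
  have e_eq: "e r = X r \<times> Y r" if "r < p" for r
    using rect[OF eP[OF that]] e_ne[OF that] by (auto simp: X_def Y_def)
  have entry: "(\<Sum>r<p. of_bool (i \<in> X r) * of_bool (j \<in> Y r)) = M $$ (i, j)"
    if ij: "i < n" "j < n'" for i j
  proof -
    have "(\<Sum>r<p. of_bool (i \<in> X r) * of_bool (j \<in> Y r)) = (\<Sum>r<p. of_bool ((i, j) \<in> e r) :: real)"
      by (intro sum.cong) (auto simp: e_eq)
    also have "\<dots> = M $$ (i, j)"
    proof (cases "(i, j) \<in> ones M")
      case True
      then obtain r where r: "r < p" "(i, j) \<in> e r"
        using part e by (auto simp: partition_on_def bij_betw_def)
      have "(i, j) \<notin> e r'" if "r' < p" "r' \<noteq> r" for r'
      proof -
        have "e r' \<noteq> e r" using e that r by (auto simp: bij_betw_def inj_on_def)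
        then have "e r' \<inter> e r = {}"
          using part eP that r by (auto simp: partition_on_def disjoint_def)
        then show ?thesis using r by blast
      qed
      then have "(\<Sum>r<p. of_bool ((i, j) \<in> e r) :: real) = 1"
        using r by (subst sum.remove[of _ r]) auto
      then show ?thesis using True by (simp add: ones_def)
    next
      case False
      then have "(\<Sum>r<p. of_bool ((i, j) \<in> e r) :: real) = 0"
        using e_sub by (intro sum.neutral) auto
      moreover have "M $$ (i, j) = 0"
        using False ij assms(3) M01[OF ij] by (auto simp: ones_def)
      ultimately show ?thesis by simp
    qed
    finally show ?thesis .
  qed
  have "M = row_mat n p X * col_mat p n' Y"
    using assms(3) entry
    by (intro eq_matI) (auto simp: row_mat_def col_mat_def scalar_prod_def atLeast0LessThan)
  moreover have "X r \<subseteq> {..<n}" "Y r \<subseteq> {..<n'}" "X r \<noteq> {}" "Y r \<noteq> {}" if "r < p" for r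
    using e_sub[OF that] e_ne[OF that] assms(3) by (auto simp: X_def Y_def ones_def)
  ultimately show thesis
    using that[of X Y] unfolding p_def by blast
qed

theorem theorem1p5:
  fixes n k :: nat
  assumes "0 < k" and "k < n"
  shows "rank_bin (D_mat n k) \<ge> min (vec_space.rank n (D_mat n k) + 1) n"
proof (rule ccontr)
  define D where "D = D_mat n k"
  define p where "p = rank_bin D"
  assume "\<not> ?thesis"
  then have p_rank: "p \<le> vec_space.rank n D" and "p < n"
    by (auto simp: p_def D_def)
  obtain P where P: "finite P" "rectangle_partition D P" "card P = p"
    using rank_bin_attained[of D] by (auto simp: p_def)
  have D: "D \<in> carrier_mat n n"
    by (simp add: D_def D_mat_def)
  have D01: "D $$ (i, j) \<in> {0, 1}" if "i < n" "j < n" for i j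
    using that by (simp add: D_def D_mat_def)
  obtain X Y where X: "\<And>r. r < p \<Longrightarrow> X r \<subseteq> {..<n}" "\<And>r. r < p \<Longrightarrow> X r \<noteq> {}"
    and Y: "\<And>r. r < p \<Longrightarrow> Y r \<subseteq> {..<n}" "\<And>r. r < p \<Longrightarrow> Y r \<noteq> {}"
    and fact: "D = row_mat n p X * col_mat p n Y"
    using rectangle_partition_factorization[OF P(1,2) D D01] P(3) by metis
  have col_sum: "(col_mat p q Y *\<^sub>v vec q v) $ r = (\<Sum>y\<in>Y r. if y < q then v y else 0)"
    if "r < p" "q \<le> n" for q r v
    using that Y(1) by (subst col_mat_mult_vec[where n = n]) (auto cong: if_cong)
  have col_sum_n: "(col_mat p n Y *\<^sub>v vec n v) $ r = (\<Sum>y\<in>Y r. v y)" if "r < p" for r v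
    using col_sum[OF that, of n v] Y(1)[OF that] by (auto intro!: sum.cong)
  note rank = row_mat_carrier col_mat_carrier p_rank[unfolded fact]
  interpret window_factorization n "n - k" p X Y
  proof unfold_locales
    show "0 < n - k" "n - k < n" using assms by auto
    show "X r \<subseteq> {..<n}" "Y r \<subseteq> {..<n}" "X r \<noteq> {}" "Y r \<noteq> {}" if "r < p" for r
      using that X Y by auto
    show "(\<Sum>r<p. of_bool (i \<in> X r) * (\<Sum>y\<in>Y r. v y)) = (\<Sum>l<n - k. v ((i + l) mod n))"
      if "i < n" for v :: "nat \<Rightarrow> real" and i
    proof -
      have "(\<Sum>r<p. of_bool (i \<in> X r) * (\<Sum>y\<in>Y r. v y)) =
          (row_mat n p X *\<^sub>v (col_mat p n Y *\<^sub>v vec n v)) $ i"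
        using that by (subst row_mat_mult_vec[OF mult_mat_vec_carrier[OF col_mat_carrier vec_carrier]])
            (auto simp: col_sum_n)
      also have "\<dots> = (D *\<^sub>v vec n v) $ i"
        unfolding fact by (subst assoc_mult_mat_vec[OF row_mat_carrier col_mat_carrier]) auto
      also have "\<dots> = (\<Sum>y<n. D $$ (i, y) * v y)"
        using that D by (simp add: scalar_prod_def atLeast0LessThan)
      also have "\<dots> = (\<Sum>l<n - k. v ((i + l) mod n))"
        unfolding D_def by (rule D_mat_window_sum[OF that])
      finally show ?thesis .
    qed
    show "c r = 0" if "\<And>i. i < n \<Longrightarrow> (\<Sum>r<p. of_bool (i \<in> X r) * c r) = 0" "r < p"
      for c :: "nat \<Rightarrow> real" and r
    proof -
      have "row_mat n p X *\<^sub>v vec p c = 0\<^sub>v n"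
      proof (rule eq_vecI)
        fix i assume "i < dim_vec (0\<^sub>v n :: real vec)"
        with that(1)[of i] show "(row_mat n p X *\<^sub>v vec p c) $ i = 0\<^sub>v n $ i"
          by (subst row_mat_mult_vec) auto
      qed (simp add: row_mat_def)
      then have "vec p c = 0\<^sub>v p"
        by (intro inner_dim_le_rank_inj[OF rank]) auto
      then show ?thesis using that(2) by (metis index_vec index_zero_vec(1))
    qed
    show "\<exists>u. \<forall>r<p. (\<Sum>y\<in>Y r. u y) = c r" for c :: "nat \<Rightarrow> real"
    proof -
      obtain u where u: "u \<in> carrier_vec n" "col_mat p n Y *\<^sub>v u = vec p c"
        using inner_dim_le_rank_surj[OF rank, of "vec p c"] by auto
      have u_vec: "vec n (\<lambda>y. u $ y) = u" using u(1) by auto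
      have "(\<Sum>y\<in>Y r. u $ y) = c r" if "r < p" for r
        using col_sum_n[OF that, of "\<lambda>y. u $ y"] that by (simp only: u_vec u(2) index_vec)
      then show ?thesis by blast
    qed
    show "\<exists>v :: nat \<Rightarrow> real. (\<exists>j<q. v j \<noteq> 0) \<and> (\<forall>j\<ge>q. v j = 0) \<and> (\<forall>r<p. (\<Sum>y\<in>Y r. v y) = 0)"
      if "p < q" "q \<le> n" for q
    proof -
      \<comment> \<open>The first \<open>q\<close> columns form a wide matrix; its kernel vector is
        then extended by zero.\<close>
      obtain v where v: "v \<in> carrier_vec q" "v \<noteq> 0\<^sub>v q" "col_mat p q Y *\<^sub>v v = 0\<^sub>v p"
        using wide_mat_kernel_nontrivial[OF col_mat_carrier \<open>p < q\<close>] by blast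
      define w where "w j = (if j < q then v $ j else 0)" for j
      have "\<exists>j<q. w j \<noteq> 0"
      proof (rule ccontr)
        assume "\<not> (\<exists>j<q. w j \<noteq> 0)"
        then have "v = 0\<^sub>v q" using v(1) by (intro eq_vecI) (auto simp: w_def)
        with v(2) show False by simp
      qed
      moreover have "(\<Sum>y\<in>Y r. w y) = 0" if "r < p" for r
        unfolding w_def col_mat_mult_vec[of v q r p n Y, OF v(1) that \<open>q \<le> n\<close> Y(1)[OF that], symmetric] v(3)
        using that by simp
      moreover have "\<forall>j\<ge>q. w j = 0" by (simp add: w_def)
      ultimately show ?thesis by blast
    qed
  qed
  show False using p_ge_n \<open>p < n\<close> by simp
qed

end
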